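(* Let $W$ be an irreducible complex reflection group acting on $V$, and let $T$ be the set of all reflections in $W$. The Cayley graph $\Gamma(W,T)$ is adjacency integral (every eigenvalue of its adjacency matrix is an integer), and the codimension spectrum of $W$ is integral (every eigenvalue of the matrix $(\operatorname{codim}(vw^{-1}))_{v,w\in W}$ is an integer).
   Context: Let $V$ be a finite-dimensional complex vector space of dimension $n$. A reflection on $V$ is a linear transformation of $V$ of finite order whose eigenspace for eigenvalue $1$ has dimension $n-1$. A complex reflection group $W$ on $V$ is a finite subgroup of $\mathrm{GL}(V)$ generated by reflections (and $V$ carries a $W$-invariant hermitian form). It is irreducible if it acts irreducibly on the orthogonal complement of its fixed point space (the fixed point space may be zero). The (left) Cayley graph $\Gamma(W,T)$ is the undirected graph with vertex set $W$ and an edge joining $g$ and $tg$ for each $g\in W$, $t\in T$. Its adjacency matrix has $(g,h)$-entry equal to the number of edges joining $g$ and $h$ (so $1$ if $gh^{-1}\in T$ and $0$ otherwise). For $w\in W$, $\operatorname{codim}(w)$ denotes the codimension in $V$ of the fixed point space $V^w=\{v\in V\mid wv=v\}$. The codimension matrix of $W$ has rows and columns indexed by $W$ with $(v,w)$-entry $\operatorname{codim}(vw^{-1})$, and the codimension spectrum is its set of eigenvalues. *)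

theory Defs
  imports Complex_Main "HOL-Algebra.Generated_Groups"
begin

text \<open>
  The vector space \<open>V\<close> is the whole type \<open>'v\<close>, with scalar multiplication
  \<open>scale\<close>; group elements are functions on \<open>'v\<close>.
\<close>

definition GL :: "(complex \<Rightarrow> 'v \<Rightarrow> 'v) \<Rightarrow> ('v::ab_group_add \<Rightarrow> 'v) monoid"
  where "GL scale =
    \<lparr>carrier = {f. Vector_Spaces.linear scale scale f \<and> bij f}, mult = (\<circ>), one = id\<rparr>"

definition fixed_space :: "('v \<Rightarrow> 'v) \<Rightarrow> 'v set"
  where "fixed_space w = {v. w v = v}"

definition codim :: "(complex \<Rightarrow> 'v \<Rightarrow> 'v) \<Rightarrow> ('v::ab_group_add \<Rightarrow> 'v) \<Rightarrow> nat"
  where "codim scale w =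
    vector_space.dim scale UNIV - vector_space.dim scale (fixed_space w)"

text \<open>
  The dimension condition is written additively, since truncated subtraction would
  make the identity of a zero-dimensional space a reflection.
\<close>

definition is_reflection :: "(complex \<Rightarrow> 'v \<Rightarrow> 'v) \<Rightarrow> ('v::ab_group_add \<Rightarrow> 'v) \<Rightarrow> bool"
  where "is_reflection scale r \<longleftrightarrow>
    Vector_Spaces.linear scale scale r \<and>
    (\<exists>k>0. r ^^ k = id) \<and>
    vector_space.dim scale (fixed_space r) + 1 = vector_space.dim scale UNIV"

definition reflections :: "(complex \<Rightarrow> 'v \<Rightarrow> 'v) \<Rightarrow> ('v::ab_group_add \<Rightarrow> 'v) set \<Rightarrow> ('v \<Rightarrow> 'v) set"
  where "reflections scale W = {t \<in> W. is_reflection scale t}"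

definition complex_reflection_group ::
    "(complex \<Rightarrow> 'v \<Rightarrow> 'v) \<Rightarrow> ('v::ab_group_add \<Rightarrow> 'v) set \<Rightarrow> bool"
  where "complex_reflection_group scale W \<longleftrightarrow>
    subgroup W (GL scale) \<and> finite W \<and>
    (\<exists>S. (\<forall>r\<in>S. is_reflection scale r) \<and> W = generate (GL scale) S)"

definition positive_hermitian_form ::
    "(complex \<Rightarrow> 'v \<Rightarrow> 'v) \<Rightarrow> ('v::ab_group_add \<Rightarrow> 'v \<Rightarrow> complex) \<Rightarrow> bool"
  where "positive_hermitian_form scale form \<longleftrightarrow>
    (\<forall>x y z. form (x + y) z = form x z + form y z) \<and>
    (\<forall>a x y. form (scale a x) y = a * form x y) \<and>
    (\<forall>x y. form y x = cnj (form x y)) \<and>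
    (\<forall>x. x \<noteq> 0 \<longrightarrow> Re (form x x) > 0)"

definition invariant_form :: "('v \<Rightarrow> 'v \<Rightarrow> complex) \<Rightarrow> ('v \<Rightarrow> 'v) set \<Rightarrow> bool"
  where "invariant_form form W \<longleftrightarrow> (\<forall>w\<in>W. \<forall>x y. form (w x) (w y) = form x y)"

definition orth_complement :: "('v \<Rightarrow> 'v \<Rightarrow> complex) \<Rightarrow> 'v set \<Rightarrow> 'v set"
  where "orth_complement form U = {v. \<forall>u\<in>U. form v u = 0}"

text \<open>As usual, the zero representation does not count as irreducible.\<close>

definition acts_irreducibly ::
    "(complex \<Rightarrow> 'v \<Rightarrow> 'v) \<Rightarrow> ('v::ab_group_add \<Rightarrow> 'v) set \<Rightarrow> 'v set \<Rightarrow> bool"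
  where "acts_irreducibly scale W U \<longleftrightarrow>
    module.subspace scale U \<and> (\<forall>w\<in>W. w ` U \<subseteq> U) \<and> U \<noteq> {0} \<and>
    (\<forall>U'. module.subspace scale U' \<and> U' \<subseteq> U \<and> (\<forall>w\<in>W. w ` U' \<subseteq> U') \<longrightarrow> U' = {0} \<or> U' = U)"

definition irreducible_group ::
    "(complex \<Rightarrow> 'v \<Rightarrow> 'v) \<Rightarrow> ('v \<Rightarrow> 'v \<Rightarrow> complex) \<Rightarrow> ('v::ab_group_add \<Rightarrow> 'v) set \<Rightarrow> bool"
  where "irreducible_group scale form W \<longleftrightarrow>
    acts_irreducibly scale W (orth_complement form (\<Inter>w\<in>W. fixed_space w))"

text \<open>
  A matrix with rows and columns indexed by \<open>I\<close> is a function of two arguments and a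
  vector is a function of one argument; only their values on \<open>I\<close> matter.
\<close>

definition spectrum_on :: "'i set \<Rightarrow> ('i \<Rightarrow> 'i \<Rightarrow> complex) \<Rightarrow> complex set"
  where "spectrum_on I A =
    {c. \<exists>x. (\<exists>i\<in>I. x i \<noteq> 0) \<and> (\<forall>i\<in>I. (\<Sum>j\<in>I. A i j * x j) = c * x i)}"

definition cayley_edges :: "('v \<Rightarrow> 'v) set \<Rightarrow> ('v \<Rightarrow> 'v) set \<Rightarrow> ('v \<Rightarrow> 'v) set set"
  where "cayley_edges W T = {{g, t \<circ> g} | g t. g \<in> W \<and> t \<in> T}"

definition adjacency_matrix :: "'i set set \<Rightarrow> 'i \<Rightarrow> 'i \<Rightarrow> complex"
  where "adjacency_matrix E g h = of_nat (card {e \<in> E. e = {g, h}})"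

definition adjacency_integral :: "'i set \<Rightarrow> 'i set set \<Rightarrow> bool"
  where "adjacency_integral V E \<longleftrightarrow> spectrum_on V (adjacency_matrix E) \<subseteq> \<int>"

definition codim_matrix ::
    "(complex \<Rightarrow> 'v \<Rightarrow> 'v) \<Rightarrow> ('v::ab_group_add \<Rightarrow> 'v) \<Rightarrow> ('v \<Rightarrow> 'v) \<Rightarrow> complex"
  where "codim_matrix scale v w =
    of_nat (codim scale (v \<otimes>\<^bsub>GL scale\<^esub> inv\<^bsub>GL scale\<^esub> w))"

definition codim_spectrum ::
    "(complex \<Rightarrow> 'v \<Rightarrow> 'v) \<Rightarrow> ('v::ab_group_add \<Rightarrow> 'v) set \<Rightarrow> complex set"
  where "codim_spectrum scale W = spectrum_on W (codim_matrix scale)"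

end

theory Submission
  imports Defs "HOL-Library.Function_Algebras" "HOL-Number_Theory.Totient"
    "HOL-Algebra.Multiplicative_Group" "Jordan_Normal_Form.Char_Poly"
begin

text \<open>
  Both matrices have the form \<open>M = (f (v w\<^sup>-\<^sup>1))\<close> with an integer-valued \<open>f\<close> depending only on
  the dimension of the fixed space, so \<open>f\<close> is a class function with \<open>f (g\<^sup>k) = f g\<close> for every \<open>k\<close>
  coprime to the group order \<open>N\<close>. An eigenspace \<open>E\<close> of \<open>M\<close> for the eigenvalue \<open>c\<close> is stable
  under left translation, and taking traces on \<open>E\<close> gives \<open>c dim E = \<Sum>\<^sub>a f(a) tr(a|E)\<close>.
  Averaging over the bijections \<open>a \<mapsto> a\<^sup>k\<close> gives
  \<open>\<phi>(N) c dim E = \<Sum>\<^sub>a f(a) \<Sum>\<^sub>k tr(a\<^sup>k|E)\<close> with \<open>k\<close> over the totatives of \<open>N\<close>. The inner sums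
  are integers: the full sum \<open>\<Sum>\<^sub>k tr(a\<^sup>k|E)\<close> over all residues is \<open>N\<close> times the trace of an
  idempotent, and sorting the residues by their gcd with \<open>N\<close> reduces to this case by induction.
  Hence \<open>c\<close> is rational, and it is an algebraic integer as an eigenvalue of an integer matrix.
\<close>

section \<open>Traces of operators on the span of an independent set\<close>

text \<open>The trace of the operator that \<open>T\<close> induces on the subspace
  \<open>span B\<close>, read off from diagonal coefficients. It is meaningful when \<open>T\<close>
  maps \<open>B\<close> into \<open>span B\<close>.\<close>

definition trace_on :: "('a::field \<Rightarrow> 'b::ab_group_add \<Rightarrow> 'b) \<Rightarrow> 'b set \<Rightarrow> ('b \<Rightarrow> 'b) \<Rightarrow> 'a"
  where "trace_on scale B T = (\<Sum>b\<in>B. module.representation scale B (T b) b)"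

context vector_space
begin

lemma trace_on_cong:
  assumes "\<And>b. b \<in> B \<Longrightarrow> S b = T b"
  shows "trace_on scale B S = trace_on scale B T"
  using assms by (simp add: trace_on_def)

lemma trace_on_sum_scale:
  assumes "independent B" and "\<And>i b. i \<in> I \<Longrightarrow> b \<in> B \<Longrightarrow> T i b \<in> span B"
  shows "trace_on scale B (\<lambda>b. \<Sum>i\<in>I. scale (c i) (T i b)) = (\<Sum>i\<in>I. c i * trace_on scale B (T i))"
proof -
  have "trace_on scale B (\<lambda>b. \<Sum>i\<in>I. scale (c i) (T i b))
      = (\<Sum>b\<in>B. \<Sum>i\<in>I. c i * representation B (T i b) b)"
    unfolding trace_on_def using assms
    by (intro sum.cong refl) (simp add: representation_sum span_scale representation_scale)
  also have "\<dots> = (\<Sum>i\<in>I. c i * trace_on scale B (T i))"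
    unfolding trace_on_def sum_distrib_left by (rule sum.swap)
  finally show ?thesis .
qed

lemma trace_on_scale_id:
  assumes "independent B"
  shows "trace_on scale B (scale c) = c * of_nat (card B)"
  unfolding trace_on_def using assms
  by (simp add: representation_scale span_base representation_basis mult.commute)

text \<open>The trace is the rank: factor \<open>T\<close> through a basis \<open>D\<close> of its
  image and use tr(XY) = tr(YX). Since \<open>T\<close> fixes each \<open>d\<close> in
  \<open>D\<close>, each contributes 1, and the trace is \<open>card D\<close>.\<close>

lemma trace_on_idempotent:
  assumes B: "independent B" "finite B"
    and T: "Vector_Spaces.linear scale scale T"
    and inv: "\<And>v. v \<in> span B \<Longrightarrow> T v \<in> span B"
    and idem: "\<And>v. v \<in> span B \<Longrightarrow> T (T v) = T v"
  shows "trace_on scale B T \<in> \<nat>"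
proof -
  interpret T: Vector_Spaces.linear scale scale T by (rule T)
  obtain D where D: "D \<subseteq> T ` span B" "independent D" "T ` span B \<subseteq> span D"
    using basis_exists by metis
  have DB: "D \<subseteq> span B" using D(1) inv by blast
  have fin: "finite D"
    using independent_span_bound[OF B(2) D(2) DB] by simp
  have fixD: "T d = d" if "d \<in> D" for d
    using that D(1) idem by auto
  have expand: "T v = (\<Sum>d\<in>D. scale (representation D (T v) d) d)" if "v \<in> span B" for v
    using that D(2,3) fin by (subst sum_representation_eq) auto
  have "trace_on scale B T = (\<Sum>b\<in>B. \<Sum>d\<in>D. representation D (T b) d * representation B d b)"
    unfolding trace_on_def
  proof (intro sum.cong refl)
    fix b assume "b \<in> B"
    hence "representation B (T b) = representation B (\<Sum>d\<in>D. scale (representation D (T b) d) d)"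
      using expand[of b] by (simp add: span_base)
    also have "\<dots> = (\<lambda>b'. \<Sum>d\<in>D. representation D (T b) d * representation B d b')"
      using B DB by (subst representation_sum) (auto simp: span_scale representation_scale span_base subset_iff)
    finally show "representation B (T b) b = (\<Sum>d\<in>D. representation D (T b) d * representation B d b)"
      by simp
  qed
  also have "\<dots> = (\<Sum>d\<in>D. \<Sum>b\<in>B. representation D (T b) d * representation B d b)"
    by (rule sum.swap)
  also have "\<dots> = (\<Sum>d\<in>D. 1)"
  proof (intro sum.cong refl)
    fix d assume d: "d \<in> D"
    have "(\<Sum>b\<in>B. representation D (T b) d * representation B d b)
        = representation D (\<Sum>b\<in>B. scale (representation B d b) (T b)) d"
    proof -
      have "T b \<in> span D" if "b \<in> B" for b using that D(3) by (auto simp: span_base)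
      thus ?thesis
        using D(2) by (subst representation_sum)
          (auto simp: span_scale representation_scale mult.commute)
    qed
    \<comment> \<open>Linearity recombines the sum into \<open>T d\<close>, so the term is the
      coefficient of \<open>d\<close> in \<open>T d = d\<close>.\<close>
    also have "(\<Sum>b\<in>B. scale (representation B d b) (T b)) = T (\<Sum>b\<in>B. scale (representation B d b) b)"
      by (simp add: T.sum T.scale)
    also have "(\<Sum>b\<in>B. scale (representation B d b) b) = d"
      using B DB d by (subst sum_representation_eq) auto
    finally show "(\<Sum>b\<in>B. representation D (T b) d * representation B d b) = 1"
      using D(2) d by (simp add: fixD representation_basis)
  qed
  finally show ?thesis by simp
qed

lemma linear_funpow:
  assumes "Vector_Spaces.linear scale scale T"
  shows "Vector_Spaces.linear scale scale (T ^^ k)"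
proof (induction k)
  case 0
  show ?case unfolding funpow_0 using linear_id by (simp add: id_def)
next
  case (Suc k)
  show ?case using Vector_Spaces.linear_compose[OF Suc assms] by (simp add: o_def)
qed

lemma funpow_span_closed:
  assumes "\<And>v. v \<in> span B \<Longrightarrow> T v \<in> span B" "v \<in> span B"
  shows "(T ^^ k) v \<in> span B"
  using assms by (induction k) auto

end

section \<open>Integrality of sums of traces of powers\<close>

text \<open>The average \<open>P\<close> of the powers over one period is a projection of
  \<open>span B\<close> onto the fixed vectors of \<open>T\<close>, so the sum is \<open>N\<close>
  times the trace of an idempotent.\<close>

lemma sum_trace_funpow_Ints:
  fixes scale :: "complex \<Rightarrow> 'v::ab_group_add \<Rightarrow> 'v"
  assumes "vector_space scale"
    and B: "module.independent scale B" "finite B"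
    and T: "Vector_Spaces.linear scale scale T"
    and inv: "\<And>v. v \<in> module.span scale B \<Longrightarrow> T v \<in> module.span scale B"
    and per: "\<And>v. v \<in> module.span scale B \<Longrightarrow> (T ^^ N) v = v"
    and "N > 0"
  shows "(\<Sum>k\<in>{0<..N}. trace_on scale B (T ^^ k)) \<in> \<int>"
proof -
  interpret vector_space scale by fact
  interpret vp: vector_space_pair scale scale ..
  define P where "P v = (\<Sum>k\<in>{0<..N}. scale (1 / of_nat N) ((T ^^ k) v))" for v
  interpret T: Vector_Spaces.linear scale scale T by (rule T)
  have linP: "Vector_Spaces.linear scale scale P"
    unfolding P_def using linear_funpow[OF T]
    by (intro vp.linear_compose_sum ballI vp.linear_compose_scale_right)
  have invP: "P v \<in> span B" if "v \<in> span B" for v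
    unfolding P_def using that inv by (intro span_sum span_scale funpow_span_closed)
  \<comment> \<open>Applying \<open>T\<close> shifts the exponents from 1..N to 2..N+1; periodicity
    turns the new last term into the missing first one.\<close>
  have TP: "T (P v) = P v" if v: "v \<in> span B" for v
  proof -
    have "T (P v) = (\<Sum>k\<in>{0<..N}. scale (1 / of_nat N) ((T ^^ Suc k) v))"
      by (simp add: P_def T.sum T.scale)
    also have "\<dots> = (\<Sum>k\<in>{1<..Suc N}. scale (1 / of_nat N) ((T ^^ k) v))"
      by (rule sum.reindex_bij_witness[of _ "\<lambda>k. k - 1" Suc]) auto
    also have "\<dots> = scale (1 / of_nat N) ((T ^^ Suc N) v)
        + (\<Sum>k\<in>{1<..N}. scale (1 / of_nat N) ((T ^^ k) v))"
    proof -
      have eq: "{1<..Suc N} = insert (Suc N) {1<..N}" using \<open>N > 0\<close> by auto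
      show ?thesis unfolding eq by (subst sum.insert) auto
    qed
    also have "(T ^^ Suc N) v = (T ^^ 1) v" using per[OF v] by simp
    also have "scale (1 / of_nat N) ((T ^^ 1) v) + (\<Sum>k\<in>{1<..N}. scale (1 / of_nat N) ((T ^^ k) v)) = P v"
    proof -
      have eq: "{0<..N} = insert 1 {1<..N}" using \<open>N > 0\<close> by auto
      show ?thesis unfolding P_def eq by (subst sum.insert) auto
    qed
    finally show ?thesis .
  qed
  have TkP: "(T ^^ k) (P v) = P v" if "v \<in> span B" for k v
    using TP[OF that] by (induction k) auto
  have idem: "P (P v) = P v" if "v \<in> span B" for v
    using that \<open>N > 0\<close> unfolding P_def[of "P v"]
    by (simp add: TkP sum_constant_scale)
  have "trace_on scale B P \<in> \<nat>"
    using B linP invP idem by (rule trace_on_idempotent)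
  moreover have "trace_on scale B P = (\<Sum>k\<in>{0<..N}. 1 / of_nat N * trace_on scale B (T ^^ k))"
    unfolding P_def using B inv
    by (intro trace_on_sum_scale) (auto intro: funpow_span_closed span_base)
  hence "(\<Sum>k\<in>{0<..N}. trace_on scale B (T ^^ k)) = of_nat N * trace_on scale B P"
    using \<open>N > 0\<close> by (simp add: sum_distrib_left)
  ultimately show ?thesis by (auto elim!: Nats_cases)
qed

text \<open>In terms of eigenvalues these are sums of Ramanujan sums. The exponents \<open>k\<close>
  with \<open>gcd k N = d\<close> are \<open>d\<close> times the totatives of
  \<open>N div d\<close>, so their class is the same kind of sum for \<open>T ^^ d\<close>, of
  period \<open>N div d\<close>. Subtracting the classes with \<open>d > 1\<close> from the full sum
  leaves the totatives.\<close>

lemma sum_totatives_trace_funpow_Ints: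
  fixes scale :: "complex \<Rightarrow> 'v::ab_group_add \<Rightarrow> 'v"
  assumes "vector_space scale"
    and B: "module.independent scale B" "finite B"
    and "Vector_Spaces.linear scale scale T"
    and "\<And>v. v \<in> module.span scale B \<Longrightarrow> T v \<in> module.span scale B"
    and "\<And>v. v \<in> module.span scale B \<Longrightarrow> (T ^^ N) v = v"
    and "N > 0"
  shows "(\<Sum>k\<in>totatives N. trace_on scale B (T ^^ k)) \<in> \<int>"
  using assms(4-7)
proof (induction N arbitrary: T rule: less_induct)
  case (less N)
  interpret vector_space scale by fact
  define S where "S d = (\<Sum>k\<in>{k\<in>{0<..N}. gcd k N = d}. trace_on scale B (T ^^ k))" for d
  have S_eq: "S d = (\<Sum>k\<in>totatives (N div d). trace_on scale B ((T ^^ d) ^^ k))" if "d dvd N" for d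
    unfolding S_def
    using sum.reindex_bij_betw[OF bij_betw_totatives_gcd_eq[OF that less.prems(4)],
        of "\<lambda>k. trace_on scale B (T ^^ k)"]
    by (simp add: funpow_mult mult.commute)
  have "(\<Sum>k\<in>{0<..N}. trace_on scale B (T ^^ k)) = (\<Sum>d\<in>{d. d dvd N}. S d)"
    unfolding S_def using less.prems(4)
    by (intro sum.group[symmetric]) auto
  also have "\<dots> = S 1 + (\<Sum>d\<in>{d. d dvd N} - {1}. S d)"
    using less.prems(4) by (intro sum.remove) auto
  finally have "S 1 = (\<Sum>k\<in>{0<..N}. trace_on scale B (T ^^ k)) - (\<Sum>d\<in>{d. d dvd N} - {1}. S d)"
    by simp
  moreover have "(\<Sum>k\<in>{0<..N}. trace_on scale B (T ^^ k)) \<in> \<int>"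
    using assms(1) B less.prems by (rule sum_trace_funpow_Ints)
  moreover have "(\<Sum>d\<in>{d. d dvd N} - {1}. S d) \<in> \<int>"
  proof (intro Ints_sum)
    fix d assume d: "d \<in> {d. d dvd N} - {1}"
    hence "d > 1" using less.prems(4) by (cases d) (auto simp: dvd_def)
    have "(\<Sum>k\<in>totatives (N div d). trace_on scale B ((T ^^ d) ^^ k)) \<in> \<int>"
    proof (rule less.IH)
      show "N div d < N" using \<open>d > 1\<close> less.prems(4) by simp
      show "N div d > 0" using d less.prems(4) by (auto simp: div_greater_zero_iff dvd_imp_le)
      show "Vector_Spaces.linear scale scale (T ^^ d)" using less.prems(1) by (rule linear_funpow)
      show "(T ^^ d) v \<in> span B" if "v \<in> span B" for v
        using less.prems(2) that by (rule funpow_span_closed)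
      show "((T ^^ d) ^^ (N div d)) v = v" if "v \<in> span B" for v
        using less.prems(3)[OF that] d by (simp add: funpow_mult)
    qed
    thus "S d \<in> \<int>" using S_eq[of d] d by simp
  qed
  ultimately have "S 1 \<in> \<int>" by simp
  thus ?case using S_eq[of 1] by simp
qed

section \<open>Eigenvalues of integer matrices\<close>

text \<open>An eigenvalue is a root of the characteristic polynomial, which is monic with integer
  coefficients. The enumeration \<open>e\<close> of \<open>I\<close> converts to matrices indexed by
  numbers.\<close>

lemma spectrum_on_int_matrix_algebraic_int:
  fixes A :: "'i \<Rightarrow> 'i \<Rightarrow> int"
  assumes "finite I" and "c \<in> spectrum_on I (\<lambda>i j. of_int (A i j))"
  shows "algebraic_int c"
proof -
  obtain x where x: "\<exists>i\<in>I. x i \<noteq> 0" "\<And>i. i \<in> I \<Longrightarrow> (\<Sum>j\<in>I. of_int (A i j) * x j) = c * x i"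
    using assms(2) by (auto simp: spectrum_on_def)
  obtain e where e: "bij_betw e {0..<card I} I"
    using ex_bij_betw_nat_finite[OF assms(1)] by blast
  define n where "n = card I"
  define M where "M = mat n n (\<lambda>(i, j). A (e i) (e j))"
  define v where "v = vec n (\<lambda>i. x (e i))"
  let ?M = "map_mat of_int M :: complex mat"
  have e_in: "e i \<in> I" if "i < n" for i using e that by (auto simp: bij_betw_def n_def)
  have M: "M \<in> carrier_mat n n" "?M \<in> carrier_mat n n" by (simp_all add: M_def)
  have "eigenvector ?M v c"
    unfolding eigenvector_def
  proof (intro conjI)
    have "\<exists>i\<in>e ` {0..<n}. x i \<noteq> 0"
      using x(1) bij_betw_imp_surj_on[OF e] by (simp add: n_def)
    thus "v \<noteq> 0\<^sub>v (dim_row ?M)"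
      using M by (auto simp: v_def vec_eq_iff)
    show "?M *\<^sub>v v = c \<cdot>\<^sub>v v"
    proof (rule eq_vecI)
      fix i assume "i < dim_vec (c \<cdot>\<^sub>v v)"
      hence i: "i < n" by (simp add: v_def)
      have "(?M *\<^sub>v v) $ i = (\<Sum>j\<in>{0..<n}. of_int (A (e i) (e j)) * x (e j))"
        using i by (simp add: M_def v_def scalar_prod_def)
      also have "\<dots> = (\<Sum>j\<in>I. of_int (A (e i) j) * x j)"
        using sum.reindex_bij_betw[OF e, of "\<lambda>j. of_int (A (e i) j) * x j"] by (simp add: n_def)
      also have "\<dots> = c * x (e i)" using x(2)[OF e_in[OF i]] .
      finally show "(?M *\<^sub>v v) $ i = (c \<cdot>\<^sub>v v) $ i" using i by (simp add: v_def)
    qed (simp add: M_def v_def)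
  qed (simp add: M_def v_def)
  hence "poly (char_poly ?M) c = 0"
    using eigenvalue_root_char_poly[OF M(2)] by (auto simp: eigenvalue_def)
  moreover have "coeff (char_poly ?M) i \<in> \<int>" for i
    by (simp add: of_int_hom.char_poly_hom[OF M(1)])
  moreover have "lead_coeff (char_poly ?M) = 1"
    using degree_monic_char_poly[OF M(2)] by simp
  ultimately show ?thesis by (intro algebraic_int.intros) auto
qed

section \<open>Complex-valued functions as a vector space\<close>

lemma vector_space_pointwise: "vector_space (\<lambda>(c::complex) x i. c * x i)"
  by unfold_locales (auto simp: fun_eq_iff algebra_simps)

lemma sum_fun_apply: "(\<Sum>a\<in>A. f a) x = (\<Sum>a\<in>A. f a x)"
  by (induction A rule: infinite_finite_induct) auto

text \<open>The index type may be infinite; this bounds the dimension of any space of functions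
  vanishing outside a finite \<open>I\<close>.\<close>

lemma finite_support_in_span:
  fixes x :: "'i \<Rightarrow> complex"
  assumes "finite I" and "\<And>i. i \<notin> I \<Longrightarrow> x i = 0"
  shows "x \<in> module.span (\<lambda>c x i. c * x i) ((\<lambda>j i. if i = j then 1 else 0) ` I)"
proof -
  interpret vector_space "\<lambda>(c::complex) x (i::'i). c * x i" by (rule vector_space_pointwise)
  have "x = (\<Sum>j\<in>I. (\<lambda>i. x j * (if i = j then 1 else 0)))"
    using assms by (auto simp: fun_eq_iff sum_fun_apply if_distrib cong: if_cong)
  also have "\<dots> \<in> span ((\<lambda>j i. if i = j then 1 else 0) ` I)"
    by (intro span_sum span_scale span_base imageI)
  finally show ?thesis .
qed

context group
begin

section \<open>Power maps and left translation in a group\<close>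

text \<open>Take \<open>j\<close> inverse to \<open>k\<close> modulo the group order.\<close>

lemma pow_coprime_invertible:
  assumes "coprime k (Coset.order G)"
  obtains j :: nat where "\<And>g. g \<in> carrier G \<Longrightarrow> (g [^] k) [^] j = g"
proof -
  obtain j where "[k * j = 1] (mod Coset.order G)"
    using assms cong_solve_coprime_nat by (metis One_nat_def)
  \<comment> \<open>Written additively to stay within the naturals; both multiples of the order
    vanish in the exponent.\<close>
  then obtain q q' where eq: "k * j + Coset.order G * q = 1 + Coset.order G * q'"
    unfolding cong_iff_lin_nat by (metis mult.commute)
  have "(g [^] k) [^] j = g" if "g \<in> carrier G" for g
  proof -
    have "g [^] (k * j + Coset.order G * q) = g [^] (1 + Coset.order G * q')"
      by (simp only: eq)
    thus ?thesis using that pow_order_eq_1[OF that]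
      by (simp add: nat_pow_mult[symmetric] nat_pow_pow[symmetric])
  qed
  thus thesis by (rule that)
qed

lemma bij_betw_pow_coprime:
  assumes "finite (carrier G)" and "coprime k (Coset.order G)"
  shows "bij_betw (\<lambda>g. g [^] k) (carrier G) (carrier G)"
proof -
  obtain j :: nat where "\<And>g. g \<in> carrier G \<Longrightarrow> (g [^] k) [^] j = g"
    using pow_coprime_invertible[OF assms(2)] by blast
  hence "inj_on (\<lambda>g. g [^] k) (carrier G)" by (rule inj_on_inverseI)
  moreover have "(\<lambda>g. g [^] k) ` carrier G \<subseteq> carrier G" by auto
  ultimately show ?thesis
    using assms(1) by (simp add: bij_betw_def endo_inj_surj)
qed

text \<open>The left regular representation. Setting the value 0 outside the carrier keeps the
  functions finitely supported when the group is finite.\<close>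

definition left_translate :: "'a \<Rightarrow> ('a \<Rightarrow> complex) \<Rightarrow> 'a \<Rightarrow> complex"
  where "left_translate a x = (\<lambda>g. if g \<in> carrier G then x (inv a \<otimes> g) else 0)"

lemma linear_left_translate:
  "Vector_Spaces.linear (\<lambda>c x i. c * x i) (\<lambda>c x i. c * x i) (left_translate a)"
  unfolding Vector_Spaces.linear_iff_module_hom
  using vector_space_pointwise
  by (auto simp: module_hom_def module_hom_axioms_def left_translate_def fun_eq_iff
      module_iff_vector_space)

lemma left_translate_mult:
  assumes "a \<in> carrier G" "b \<in> carrier G"
  shows "left_translate a (left_translate b x) = left_translate (a \<otimes> b) x"
  using assms by (auto simp: left_translate_def fun_eq_iff inv_mult_group m_assoc)

lemma left_translate_one:
  assumes "\<And>g. g \<notin> carrier G \<Longrightarrow> x g = 0"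
  shows "left_translate \<one> x = x"
  using assms by (auto simp: left_translate_def fun_eq_iff)

lemma left_translate_pow:
  assumes "a \<in> carrier G" and "\<And>g. g \<notin> carrier G \<Longrightarrow> x g = 0"
  shows "(left_translate a ^^ k) x = left_translate (a [^] k) x"
proof (induction k)
  case (Suc k)
  thus ?case using assms(1) nat_pow_Suc2[of a k]
    by (simp add: left_translate_mult)
qed (simp add: left_translate_one assms)

text \<open>Substituting \<open>a = g \<otimes> inv h\<close> shows that the matrix with entries
  \<open>f (g \<otimes> inv h)\<close> acts as the combination of the translations with coefficients
  \<open>f a\<close>.\<close>

lemma sum_left_translate:
  assumes "g \<in> carrier G"
  shows "(\<Sum>a\<in>carrier G. f a * left_translate a x g) = (\<Sum>h\<in>carrier G. f (g \<otimes> inv h) * x h)"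
proof -
  have "g \<otimes> (inv g \<otimes> a) = a" if "a \<in> carrier G" for a
    using that assms by (simp add: m_assoc[symmetric])
  thus ?thesis
    by (intro sum.reindex_bij_witness[of _ "\<lambda>h. g \<otimes> inv h" "\<lambda>a. inv a \<otimes> g"])
      (use assms in \<open>auto simp: left_translate_def inv_mult_group m_assoc\<close>)
qed

section \<open>Integral spectra of group matrices\<close>

text \<open>Invariance under conjugation makes eigenspaces stable under left translation; invariance
  under coprime powers lets the trace identity be averaged to a rational one.\<close>

theorem spectrum_on_group_matrix_Ints:
  fixes f :: "'a \<Rightarrow> int"
  assumes fin: "finite (carrier G)"
    and conj: "\<And>g h. g \<in> carrier G \<Longrightarrow> h \<in> carrier G \<Longrightarrow> f (h \<otimes> g \<otimes> inv h) = f g"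
    and pow: "\<And>g k. g \<in> carrier G \<Longrightarrow> coprime k (Coset.order G) \<Longrightarrow> f (g [^] k) = f g"
  shows "spectrum_on (carrier G) (\<lambda>g h. of_int (f (g \<otimes> inv h))) \<subseteq> \<int>"
proof
  fix c assume c: "c \<in> spectrum_on (carrier G) (\<lambda>g h. of_int (f (g \<otimes> inv h)))"
  let ?s = "\<lambda>(c::complex) x (i::'a). c * x i"
  interpret vector_space ?s by (rule vector_space_pointwise)
  define N where "N = Coset.order G"
  have N: "N > 0" using fin by (simp add: N_def order_gt_0_iff_finite)
  \<comment> \<open>The eigenspace of \<open>c\<close>, cut down to functions supported on the
    carrier so that it has a finite basis.\<close>
  define E where "E = {x. (\<forall>g. g \<notin> carrier G \<longrightarrow> x g = 0) \<and>
    (\<forall>g\<in>carrier G. (\<Sum>h\<in>carrier G. of_int (f (g \<otimes> inv h)) * x h) = c * x g)}"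
  have "subspace E"
    unfolding subspace_def E_def
    by (auto simp: algebra_simps sum.distrib sum_distrib_left[symmetric])
  obtain B where B: "B \<subseteq> E" "independent B" "E \<subseteq> span B"
    using basis_exists by metis
  have spanB: "span B = E" using B \<open>subspace E\<close> span_minimal by blast
  have "E \<subseteq> span ((\<lambda>j i. if i = j then 1 else 0) ` carrier G)"
    using finite_support_in_span[OF fin] by (auto simp: E_def)
  hence finB: "finite B"
    using independent_span_bound[OF finite_imageI[OF fin] B(2)] B(1) by blast
  have "B \<noteq> {}"
  proof
    assume "B = {}"
    hence E0: "E = {0}" using spanB by simp
    obtain x where x: "\<exists>g\<in>carrier G. x g \<noteq> 0"
      "\<forall>g\<in>carrier G. (\<Sum>h\<in>carrier G. of_int (f (g \<otimes> inv h)) * x h) = c * x g"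
      using c by (auto simp: spectrum_on_def)
    have "(\<lambda>g. if g \<in> carrier G then x g else 0) \<in> E" using x(2) by (simp add: E_def)
    hence "(\<lambda>g. if g \<in> carrier G then x g else 0) = 0" unfolding E0 by blast
    thus False using x(1) by (auto simp: fun_eq_iff split: if_splits)
  qed
  have E_closed: "left_translate a x \<in> E" if a: "a \<in> carrier G" and x: "x \<in> E" for a x
  proof -
    have "(\<Sum>h\<in>carrier G. of_int (f (g \<otimes> inv h)) * left_translate a x h) = c * left_translate a x g"
      if g: "g \<in> carrier G" for g
    proof -
      have "(\<Sum>h\<in>carrier G. of_int (f (g \<otimes> inv h)) * left_translate a x h)
          = (\<Sum>h\<in>carrier G. of_int (f ((inv a \<otimes> g) \<otimes> inv h)) * x h)"
      \<comment> \<open>After \<open>h\<close> is replaced by \<open>inv a \<otimes> h\<close>, the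
        two arguments of \<open>f\<close> are conjugate by \<open>inv a\<close>.\<close>
      proof (rule sum.reindex_bij_witness[of _ "\<lambda>h. a \<otimes> h" "\<lambda>h. inv a \<otimes> h"])
        fix h assume h: "h \<in> carrier G"
        have "f (inv a \<otimes> (g \<otimes> inv h) \<otimes> inv (inv a)) = f (g \<otimes> inv h)"
          using a g h by (intro conj) auto
        thus "of_int (f ((inv a \<otimes> g) \<otimes> inv (inv a \<otimes> h))) * x (inv a \<otimes> h)
            = of_int (f (g \<otimes> inv h)) * left_translate a x h"
          using a g h by (simp add: left_translate_def inv_mult_group m_assoc)
      qed (use a in \<open>auto simp: m_assoc[symmetric]\<close>)
      also have "\<dots> = c * x (inv a \<otimes> g)" using x a g by (simp add: E_def)
      finally show ?thesis using g by (simp add: left_translate_def)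
    qed
    thus ?thesis by (auto simp: E_def left_translate_def)
  qed
  have pow_E: "(left_translate a ^^ k) x = left_translate (a [^] k) x"
    if "a \<in> carrier G" "x \<in> E" for a x k
    using that by (intro left_translate_pow) (auto simp: E_def)
  define t where "t a = trace_on ?s B (left_translate a)" for a
  \<comment> \<open>The combination of translations acts on \<open>E\<close> as the scalar
    \<open>c\<close>; compare traces.\<close>
  have c_trace: "c * of_nat (card B) = (\<Sum>a\<in>carrier G. of_int (f a) * t a)"
  proof -
    have "(\<Sum>a\<in>carrier G. of_int (f a) * t a)
        = trace_on ?s B (\<lambda>x. \<Sum>a\<in>carrier G. ?s (of_int (f a)) (left_translate a x))"
      unfolding t_def using B(1,2) E_closed spanB
      by (intro trace_on_sum_scale[symmetric]) auto
    also have "\<dots> = trace_on ?s B (?s c)"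
    proof (rule trace_on_cong)
      fix x assume "x \<in> B"
      hence x: "x \<in> E" using B(1) by blast
      show "(\<Sum>a\<in>carrier G. ?s (of_int (f a)) (left_translate a x)) = ?s c x"
      proof
        fix g
        show "(\<Sum>a\<in>carrier G. ?s (of_int (f a)) (left_translate a x)) g = ?s c x g"
        proof (cases "g \<in> carrier G")
          case True
          thus ?thesis using x sum_left_translate[OF True, of "\<lambda>a. of_int (f a)" x]
            by (simp add: sum_fun_apply E_def)
        next
          case False
          thus ?thesis using x by (simp add: sum_fun_apply E_def left_translate_def)
        qed
      qed
    qed
    finally show ?thesis using trace_on_scale_id[OF B(2)] by simp
  qed
  \<comment> \<open>Replace \<open>f a\<close> by \<open>f (a [^] k)\<close>, then reindex along the
    bijection \<open>a \<mapsto> a [^] k\<close>.\<close>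
  have "(\<Sum>a\<in>carrier G. of_int (f a) * t (a [^] k)) = c * of_nat (card B)"
    if "k \<in> totatives N" for k
  proof -
    have k: "coprime k (Coset.order G)" using that by (simp add: in_totatives_iff N_def)
    have "(\<Sum>a\<in>carrier G. of_int (f a) * t (a [^] k))
        = (\<Sum>a\<in>carrier G. of_int (f (a [^] k)) * t (a [^] k))"
      using pow k by (intro sum.cong) auto
    also have "\<dots> = (\<Sum>a\<in>carrier G. of_int (f a) * t a)"
      by (rule sum.reindex_bij_betw[OF bij_betw_pow_coprime[OF fin k], of "\<lambda>a. of_int (f a) * t a"])
    finally show ?thesis using c_trace by simp
  qed
  hence "of_nat (card (totatives N)) * (c * of_nat (card B))
      = (\<Sum>k\<in>totatives N. \<Sum>a\<in>carrier G. of_int (f a) * t (a [^] k))"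
    by simp
  also have "\<dots> = (\<Sum>a\<in>carrier G. of_int (f a) * (\<Sum>k\<in>totatives N. t (a [^] k)))"
    unfolding sum_distrib_left by (rule sum.swap)
  also have "\<dots> \<in> \<int>"
  proof (rule Ints_sum, rule Ints_mult[OF Ints_of_int])
    fix a assume a: "a \<in> carrier G"
    have "(\<Sum>k\<in>totatives N. t (a [^] k)) = (\<Sum>k\<in>totatives N. trace_on ?s B (left_translate a ^^ k))"
      unfolding t_def using a B(1) pow_E by (intro sum.cong refl trace_on_cong) auto
    also have "\<dots> \<in> \<int>"
    proof (rule sum_totatives_trace_funpow_Ints[OF vector_space_pointwise B(2) finB linear_left_translate _ _ N])
      fix x assume "x \<in> span B"
      hence x: "x \<in> E" using spanB by simp
      show "left_translate a x \<in> span B" using E_closed[OF a x] spanB by simp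
      show "(left_translate a ^^ N) x = x"
        using x a by (simp add: pow_E N_def pow_order_eq_1 left_translate_one E_def)
    qed
    finally show "(\<Sum>k\<in>totatives N. t (a [^] k)) \<in> \<int>" .
  qed
  \<comment> \<open>A nonzero integer multiple of \<open>c\<close> is an integer, so
    \<open>c\<close> is rational; a rational algebraic integer is an integer.\<close>
  finally have "of_nat (card (totatives N) * card B) * c \<in> \<int>" by (simp add: mult_ac)
  moreover have "card (totatives N) * card B \<noteq> 0"
    using N finB \<open>B \<noteq> {}\<close> by simp
  ultimately have "c \<in> \<rat>"
    by (metis Ints_subset_Rats Rats_divide Rats_of_nat nonzero_mult_div_cancel_left of_nat_eq_0_iff subset_iff)
  moreover have "algebraic_int c"
    using fin c by (rule spectrum_on_int_matrix_algebraic_int)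
  ultimately show "c \<in> \<int>" using rational_algebraic_int_is_int by blast
qed

end

section \<open>Fixed spaces and the general linear group\<close>

lemma spectrum_on_cong:
  assumes "\<And>i j. i \<in> I \<Longrightarrow> j \<in> I \<Longrightarrow> A i j = A' i j"
  shows "spectrum_on I A = spectrum_on I A'"
  using assms by (auto simp: spectrum_on_def)

lemma fixed_space_funpow: "fixed_space w \<subseteq> fixed_space (w ^^ k)"
  by (induction k) (auto simp: fixed_space_def)

lemma fixed_space_inv_into:
  assumes "bij w"
  shows "fixed_space (inv_into UNIV w) = fixed_space w"
  using assms by (auto simp: fixed_space_def) (metis bij_inv_eq_iff)+

text \<open>A vector is fixed by the conjugate exactly if its preimage under \<open>h\<close> is
  fixed by \<open>w\<close>.\<close>

lemma fixed_space_conjugate: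
  assumes "bij h"
  shows "fixed_space (h \<circ> w \<circ> inv_into UNIV h) = h ` fixed_space w"
  using assms unfolding fixed_space_def
  by (auto simp: image_iff bij_is_inj inv_f_f) (metis bij_inv_eq_iff)

lemma group_GL:
  assumes "finite_dimensional_vector_space scale Basis"
  shows "group (GL scale)"
proof -
  interpret finite_dimensional_vector_space scale Basis by fact
  show ?thesis
  proof (rule groupI)
    fix f assume f: "f \<in> carrier (GL scale)"
    hence "inv_into UNIV f \<in> carrier (GL scale)"
      by (simp add: GL_def inj_linear_imp_inv_linear bij_is_inj bij_imp_bij_inv)
    moreover have "inv_into UNIV f \<circ> f = id"
      using f by (simp add: GL_def bij_is_inj)
    ultimately show "\<exists>g\<in>carrier (GL scale). g \<otimes>\<^bsub>GL scale\<^esub> f = \<one>\<^bsub>GL scale\<^esub>"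
      by (auto simp: GL_def)
  qed (auto simp: GL_def bij_comp o_assoc linear_id intro: Vector_Spaces.linear_compose)
qed

lemma inv_GL:
  assumes "finite_dimensional_vector_space scale Basis" and "f \<in> carrier (GL scale)"
  shows "inv\<^bsub>GL scale\<^esub> f = inv_into UNIV f"
proof -
  interpret finite_dimensional_vector_space scale Basis by fact
  interpret group "GL scale" using assms(1) by (rule group_GL)
  show ?thesis
    using assms(2)
    by (intro inv_equality) (auto simp: GL_def inj_linear_imp_inv_linear bij_is_inj bij_imp_bij_inv)
qed

section \<open>Finite linear groups and their two spectra\<close>

locale finite_linear_group =
  fixes scale :: "complex \<Rightarrow> 'v::ab_group_add \<Rightarrow> 'v" and Basis W
  assumes fdvs: "finite_dimensional_vector_space scale Basis"
    and subgroup_W: "subgroup W (GL scale)"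
    and finite_W: "finite W"
begin

sublocale finite_dimensional_vector_space scale Basis
  by (rule fdvs)

abbreviation "G \<equiv> (GL scale)\<lparr>carrier := W\<rparr>"

sublocale G: group G
  using group.subgroup_imp_group[OF group_GL[OF fdvs] subgroup_W] .

lemma W_linear: "w \<in> W \<Longrightarrow> Vector_Spaces.linear scale scale w"
  and W_bij: "w \<in> W \<Longrightarrow> bij w"
  using subgroup.subset[OF subgroup_W] by (auto simp: GL_def)

lemma mult_G: "v \<otimes>\<^bsub>G\<^esub> w = v \<circ> w"
  by (simp add: GL_def)

lemma one_G: "\<one>\<^bsub>G\<^esub> = id"
  by (simp add: GL_def)

lemma inv_GL_W: "w \<in> W \<Longrightarrow> inv\<^bsub>GL scale\<^esub> w = inv_into UNIV w"
  using inv_GL[OF fdvs] subgroup.subset[OF subgroup_W] by blast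

lemma inv_G: "w \<in> W \<Longrightarrow> inv\<^bsub>G\<^esub> w = inv_into UNIV w"
  using group.m_inv_consistent[OF group_GL[OF fdvs] subgroup_W] inv_GL_W by simp

lemma pow_G: "w [^]\<^bsub>G\<^esub> (k::nat) = w ^^ k"
proof (induction k)
  case (Suc k)
  thus ?case by (simp only: G.nat_pow_Suc mult_G funpow_Suc_right)
qed (simp add: one_G)

lemma dim_fixed_space_conjugate:
  assumes "g \<in> W" "h \<in> W"
  shows "dim (fixed_space (h \<otimes>\<^bsub>G\<^esub> g \<otimes>\<^bsub>G\<^esub> inv\<^bsub>G\<^esub> h)) = dim (fixed_space g)"
proof -
  interpret vp: finite_dimensional_vector_space_pair_1 scale Basis scale ..
  have "dim (h ` fixed_space g) = dim (fixed_space g)"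
    using W_linear[OF assms(2)] W_bij[OF assms(2)]
    by (intro vp.dim_image_eq) (auto simp: bij_def intro: inj_on_subset)
  thus ?thesis
    using assms by (simp only: mult_G inv_G fixed_space_conjugate W_bij)
qed

text \<open>Powers can only enlarge the fixed space, and \<open>g\<close> is in turn a power of
  \<open>g ^^ k\<close>.\<close>

lemma fixed_space_pow_coprime:
  assumes "g \<in> W" "coprime k (Coset.order G)"
  shows "fixed_space (g [^]\<^bsub>G\<^esub> k) = fixed_space g"
proof -
  have "finite (carrier G)" using finite_W by simp
  then obtain j where "(g [^]\<^bsub>G\<^esub> k) [^]\<^bsub>G\<^esub> (j::nat) = g"
    using G.pow_coprime_invertible[of k] assms by auto
  thus ?thesis
    using fixed_space_funpow[of "g ^^ k" j] fixed_space_funpow[of g k]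
    unfolding pow_G by auto
qed

text \<open>Serves both matrices: \<open>F\<close> becomes the codimension in one case and the
  indicator of the reflections in the other.\<close>

lemma spectrum_fixed_space_dim_Ints:
  "spectrum_on W (\<lambda>g h. of_int (F (dim (fixed_space (g \<otimes>\<^bsub>G\<^esub> inv\<^bsub>G\<^esub> h))))) \<subseteq> \<int>"
proof -
  have "spectrum_on (carrier G)
    (\<lambda>g h. of_int (F (dim (fixed_space (g \<otimes>\<^bsub>G\<^esub> inv\<^bsub>G\<^esub> h))))) \<subseteq> \<int>"
    using finite_W dim_fixed_space_conjugate fixed_space_pow_coprime
    by (intro G.spectrum_on_group_matrix_Ints) simp_all
  thus ?thesis by simp
qed

lemma codim_spectrum_Ints: "codim_spectrum scale W \<subseteq> \<int>"
proof -
  have "codim_spectrum scale W = spectrum_on W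
    (\<lambda>g h. of_int (int (dim UNIV - dim (fixed_space (g \<otimes>\<^bsub>G\<^esub> inv\<^bsub>G\<^esub> h)))))"
    unfolding codim_spectrum_def codim_matrix_def codim_def
    by (rule spectrum_on_cong) (simp add: inv_GL_W inv_G)
  thus ?thesis
    using spectrum_fixed_space_dim_Ints[of "\<lambda>d. int (dim UNIV - d)"] by simp
qed

text \<open>Finite order follows by raising to the group order, and linearity from membership in
  \<open>W\<close>. Thus the indicator of the reflections on \<open>W\<close> depends on the fixed
  space dimension alone.\<close>

lemma reflections_iff:
  "t \<in> reflections scale W \<longleftrightarrow> t \<in> W \<and> dim (fixed_space t) + 1 = dim UNIV"
proof -
  have "\<exists>k>0. t ^^ k = id" if "t \<in> W"
    using G.pow_order_eq_1[of t] that finite_W G.order_gt_0_iff_finite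
    by (auto simp: pow_G one_G simp del: G.pow_order_eq_1)
  thus ?thesis
    using W_linear by (auto simp: reflections_def is_reflection_def)
qed

text \<open>An undirected edge may arise from either endpoint. The two cases give \<open>t\<close>
  or its inverse, which has the same fixed space and so is again a reflection.\<close>

lemma cayley_edge_iff:
  assumes "g \<in> W" "h \<in> W"
  shows "{g, h} \<in> cayley_edges W (reflections scale W)
    \<longleftrightarrow> g \<circ> inv_into UNIV h \<in> reflections scale W"
proof
  assume "{g, h} \<in> cayley_edges W (reflections scale W)"
  then obtain a t where t: "t \<in> reflections scale W" "{g, h} = {a, t \<circ> a}"
    by (auto simp: cayley_edges_def)
  have inv: "inv_into UNIV t \<in> reflections scale W"
    using t(1) G.inv_closed[of t] by (auto simp: reflections_iff inv_G fixed_space_inv_into W_bij)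
  from t(2) consider "g = t \<circ> h" | "h = t \<circ> g" by (auto simp: doubleton_eq_iff)
  thus "g \<circ> inv_into UNIV h \<in> reflections scale W"
  proof cases
    case 1
    hence "g \<circ> inv_into UNIV h = t"
      using W_bij[OF assms(2)] by (simp add: o_assoc[symmetric] surj_iff[THEN iffD1, OF bij_is_surj])
    thus ?thesis using t(1) by simp
  next
    case 2
    hence "g \<circ> inv_into UNIV h = inv_into UNIV t"
      using W_bij[OF assms(1)] t(1) W_bij
      by (auto simp: o_inv_distrib reflections_iff o_assoc bij_is_surj surj_iff[THEN iffD1])
    thus ?thesis using inv by simp
  qed
next
  assume *: "g \<circ> inv_into UNIV h \<in> reflections scale W"
  have "g = (g \<circ> inv_into UNIV h) \<circ> h"
    using W_bij[OF assms(2)] by (simp add: o_assoc[symmetric] bij_is_inj)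
  hence "{g, h} = {h, (g \<circ> inv_into UNIV h) \<circ> h}" by auto
  thus "{g, h} \<in> cayley_edges W (reflections scale W)"
    using * assms(2) unfolding cayley_edges_def by blast
qed

lemma adjacency_integral_cayley:
  "adjacency_integral W (cayley_edges W (reflections scale W))"
proof -
  let ?E = "cayley_edges W (reflections scale W)"
  have "adjacency_matrix ?E g h
      = of_int (if dim (fixed_space (g \<otimes>\<^bsub>G\<^esub> inv\<^bsub>G\<^esub> h)) + 1 = dim UNIV then 1 else 0)"
    if "g \<in> W" "h \<in> W" for g h
  proof -
    \<comment> \<open>Edges are sets of endpoints, so at most one joins \<open>g\<close> and
      \<open>h\<close> and the entry is 0 or 1.\<close>
    have "{e \<in> ?E. e = {g, h}} = (if {g, h} \<in> ?E then {{g, h}} else {})" by auto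
    moreover have "g \<circ> inv_into UNIV h \<in> W"
      using G.m_closed[of g "inv\<^bsub>G\<^esub> h"] G.inv_closed[of h] that
      unfolding mult_G by (simp add: inv_G)
    ultimately show ?thesis
      using that unfolding mult_G
      by (simp add: adjacency_matrix_def cayley_edge_iff reflections_iff inv_G)
  qed
  hence "spectrum_on W (adjacency_matrix ?E) = spectrum_on W (\<lambda>g h.
      of_int (if dim (fixed_space (g \<otimes>\<^bsub>G\<^esub> inv\<^bsub>G\<^esub> h)) + 1 = dim UNIV then 1 else 0))"
    by (rule spectrum_on_cong)
  thus ?thesis
    unfolding adjacency_integral_def
    using spectrum_fixed_space_dim_Ints[of "\<lambda>d. if d + 1 = dim UNIV then 1 else 0"] by simp
qed

end

theorem corollary4p11:
  fixes scale :: "complex \<Rightarrow> 'v::ab_group_add \<Rightarrow> 'v"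
    and Basis :: "'v set"
    and form :: "'v \<Rightarrow> 'v \<Rightarrow> complex"
    and W :: "('v \<Rightarrow> 'v) set"
  assumes "finite_dimensional_vector_space scale Basis"
    and "complex_reflection_group scale W"
    and "positive_hermitian_form scale form"
    and "invariant_form form W"
    and "irreducible_group scale form W"
  shows "adjacency_integral W (cayley_edges W (reflections scale W)) \<and>
    codim_spectrum scale W \<subseteq> \<int>"
proof -
  interpret finite_linear_group scale Basis W
    using assms(1,2) by (auto simp: finite_linear_group_def complex_reflection_group_def)
  show ?thesis using adjacency_integral_cayley codim_spectrum_Ints ..
qed

end
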